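(* Assume $\Delta(x^0)\neq0$ and let $y_1,\dots,y_{d-l}$ be the solutions, with values in $V$, of the iterated differential system $$\frac{\partial y_1}{\partial t_1}(t_1)=v_1(y_1(t_1)),\quad y_1(0)=x^0,$$ $$\frac{\partial y_j}{\partial t_j}(t_1,\dots,t_j)=v_j(y_j(t_1,\dots,t_j)),\quad y_j(t_1,\dots,t_{j-1},0)=y_{j-1}(t_1,\dots,t_{j-1}),\qquad j=2,\dots,d-l,$$ where $y_j$ is defined on $I_1\times\dots\times I_j$ and $I_1,\dots,I_{d-l}$ are closed intervals containing $0$ in their interior. Then, for every $k=1,\dots,l$ and $j=1,\dots,d-l$, $$F_k(y_j(t_1,\dots,t_j))=0,\qquad \forall\,(t_1,\dots,t_j)\in I_1\times\dots\times I_j.$$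
   Context: Setting: $1\le l\le d-1$ are integers, $\Omega\subset\mathbb{R}^d$ is a bounded domain, $x^0\in\Omega$, $F_1,\dots,F_l\in C^1(\Omega)$ are real valued and $F_j(x^0)=0$ for $j=1,\dots,l$. Let $A(x)=\left(\frac{\partial F_i}{\partial x_j}(x)\right)_{1\le i,j\le l}$ and $\Delta(x)=\det A(x)$. When $\Delta(x^0)\ne0$, $V\subset\Omega$ denotes an open neighbourhood of $x^0$ on which $\Delta\neq 0$. Vector fields: for $s=1,\dots,d-l$ and $x\in V$, $v_s(x)\in\mathbb{R}^d$ is the unique vector with $v_s(x)\cdot\nabla F_j(x)=0$ for $j=1,\dots,l$ whose last $d-l$ components are the $s$-th row of the identity matrix of $\mathbb{R}^{d-l}$ multiplied by $\Delta(x)$ (the $(l+s)$-th component is $\Delta(x)$ and the other components with index in $\{l+1,\dots,d\}$ are $0$). Each subsystem is an ordinary differential system in $V$ in the variable $t_j$, with $t_1,\dots,t_{j-1}$ as parameters. *)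

theory Defs
  imports "HOL-Analysis.Analysis"
begin

text \<open>
  The first \<open>l\<close> coordinates of \<open>\<real>\<^sup>d\<close> are indexed by the finite type \<open>'l\<close> and the last
  \<open>d - l\<close> coordinates by the finite type \<open>'m\<close>, so \<open>\<real>\<^sup>d\<close> is \<open>real ^ ('l + 'm)\<close> with
  \<open>l = CARD('l)\<close> and \<open>d - l = CARD('m)\<close>.  Both cardinalities are positive, which is
  \<open>1 \<le> l \<le> d - 1\<close>.
\<close>

definition partial_deriv :: "(real ^ 'n \<Rightarrow> real) \<Rightarrow> 'n::finite \<Rightarrow> real ^ 'n \<Rightarrow> real" where
  "partial_deriv f i x = frechet_derivative f (at x) (axis i 1)"

definition grad :: "(real ^ 'n \<Rightarrow> real) \<Rightarrow> real ^ 'n \<Rightarrow> real ^ 'n::finite" where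
  "grad f x = (\<chi> i. partial_deriv f i x)"

text \<open>Only meaningful for open \<open>\<Omega>\<close>, since the derivatives are taken at interior points.\<close>

definition C1_on :: "(real ^ 'n::finite) set \<Rightarrow> (real ^ 'n \<Rightarrow> real) \<Rightarrow> bool" where
  "C1_on \<Omega> f \<longleftrightarrow>
     (\<forall>x\<in>\<Omega>. f differentiable (at x)) \<and> (\<forall>i. continuous_on \<Omega> (partial_deriv f i))"

definition jac :: "('l::finite \<Rightarrow> real ^ ('l + 'm::finite) \<Rightarrow> real) \<Rightarrow> real ^ ('l + 'm) \<Rightarrow> real ^ 'l ^ 'l"
  where "jac F x = (\<chi> i j. partial_deriv (F i) (Inl j) x)"

definition Delta :: "('l::finite \<Rightarrow> real ^ ('l + 'm::finite) \<Rightarrow> real) \<Rightarrow> real ^ ('l + 'm) \<Rightarrow> real"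
  where "Delta F x = det (jac F x)"

definition is_field_vector ::
  "('l::finite \<Rightarrow> real ^ ('l + 'm::finite) \<Rightarrow> real) \<Rightarrow> 'm \<Rightarrow> real ^ ('l + 'm) \<Rightarrow> real ^ ('l + 'm) \<Rightarrow> bool"
  where "is_field_vector F s x w \<longleftrightarrow>
     (\<forall>j. w \<bullet> grad (F j) x = 0) \<and> (\<forall>r. w $ Inr r = (if r = s then Delta F x else 0))"

definition vfield ::
  "('l::finite \<Rightarrow> real ^ ('l + 'm::finite) \<Rightarrow> real) \<Rightarrow> 'm \<Rightarrow> real ^ ('l + 'm) \<Rightarrow> real ^ ('l + 'm)"
  where "vfield F s x = (THE w. is_field_vector F s x w)"

lemma sum_UNIV_Plus:
  fixes f :: "'l::finite + 'm::finite \<Rightarrow> real"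
  shows "sum f UNIV = (\<Sum>i\<in>UNIV. f (Inl i)) + (\<Sum>r\<in>UNIV. f (Inr r))"
  unfolding UNIV_Plus_UNIV[symmetric] by (subst sum.Plus) auto

text \<open>The definite description in \<open>vfield\<close> is proper wherever \<open>Delta\<close> does not vanish.\<close>

lemma ex1_is_field_vector:
  fixes F :: "'l::finite \<Rightarrow> real ^ ('l + 'm::finite) \<Rightarrow> real"
  assumes "Delta F x \<noteq> 0"
  shows "\<exists>!w. is_field_vector F s x w"
proof -
  define b :: "real ^ 'l" where "b = (\<chi> j. - (Delta F x * partial_deriv (F j) (Inr s) x))"
  have inv: "invertible (jac F x)"
    using assms by (simp add: Delta_def invertible_det_nz)
  have key: "is_field_vector F s x w \<longleftrightarrow>
      jac F x *v (\<chi> i. w $ Inl i) = b \<and> (\<forall>r. w $ Inr r = (if r = s then Delta F x else 0))" for w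
  proof -
    have "w \<bullet> grad (F j) x = 0 \<longleftrightarrow> (jac F x *v (\<chi> i. w $ Inl i)) $ j = b $ j"
      if *: "\<forall>r. w $ Inr r = (if r = s then Delta F x else 0)" for j
    proof -
      have "(\<Sum>r\<in>UNIV. w $ Inr r * partial_deriv (F j) (Inr r) x)
          = (\<Sum>r\<in>UNIV. if r = s then Delta F x * partial_deriv (F j) (Inr s) x else 0)"
        by (rule sum.cong) (use * in auto)
      then have "w \<bullet> grad (F j) x = (jac F x *v (\<chi> i. w $ Inl i)) $ j - b $ j"
        by (simp add: inner_vec_def grad_def sum_UNIV_Plus matrix_vector_mult_def jac_def
            b_def mult.commute)
      then show ?thesis by simp
    qed
    then show ?thesis
      unfolding is_field_vector_def vec_eq_iff[of "jac F x *v _"] by blast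
  qed
  obtain B where B: "B ** jac F x = mat 1" "jac F x ** B = mat 1"
    using inv by (auto simp: invertible_def)
  show ?thesis
  proof (rule ex1I)
    let ?w = "\<chi> i. case i of Inl a \<Rightarrow> (B *v b) $ a | Inr r \<Rightarrow> if r = s then Delta F x else 0"
    show "is_field_vector F s x ?w"
      unfolding key by (simp add: matrix_vector_mul_assoc B)
    fix w assume w: "is_field_vector F s x w"
    then have "(\<chi> i. w $ Inl i) = B *v b"
      unfolding key by (metis B(1) matrix_vector_mul_assoc matrix_vector_mul_lid)
    then have "w $ Inl a = (B *v b) $ a" for a
      by (metis vec_lambda_beta)
    then show "w = ?w"
      using w unfolding key by (auto simp: vec_eq_iff split: sum.split)
  qed
qed

text \<open>
  Points \<open>(t\<^sub>1, \<dots>, t\<^sub>j)\<close> are lists of length \<open>j\<close>; the list position \<open>i\<close> holds \<open>t\<^bsub>i+1\<^esub>\<close>.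
\<close>

definition param_box :: "(nat \<Rightarrow> real set) \<Rightarrow> nat \<Rightarrow> real list set" where
  "param_box I j = {ts. length ts = j \<and> (\<forall>i<j. ts ! i \<in> I (Suc i))}"

text \<open>
  The enumeration \<open>e\<close> of \<open>'m\<close> fixes the order \<open>v\<^sub>1, v\<^sub>2, \<dots>\<close> of the vector fields.  At an
  end point of \<open>I j\<close> the derivative in \<open>t\<^sub>j\<close> is the one-sided one.
\<close>

definition iterated_solution ::
  "('l::finite \<Rightarrow> real ^ ('l + 'm::finite) \<Rightarrow> real) \<Rightarrow> (nat \<Rightarrow> 'm) \<Rightarrow> real ^ ('l + 'm)
    \<Rightarrow> (real ^ ('l + 'm)) set \<Rightarrow> (nat \<Rightarrow> real set) \<Rightarrow> (nat \<Rightarrow> real list \<Rightarrow> real ^ ('l + 'm)) \<Rightarrow> bool"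
  where "iterated_solution F e x0 V I y \<longleftrightarrow>
     (\<forall>j\<in>{1..CARD('m)}. \<forall>ts\<in>param_box I j. y j ts \<in> V) \<and>
     (\<forall>j\<in>{1..CARD('m)}. \<forall>ts\<in>param_box I (j - 1). \<forall>t\<in>I j.
        ((\<lambda>\<tau>. y j (ts @ [\<tau>])) has_vector_derivative vfield F (e j) (y j (ts @ [t])))
          (at t within I j)) \<and>
     y 1 [0] = x0 \<and>
     (\<forall>j\<in>{2..CARD('m)}. \<forall>ts\<in>param_box I (j - 1). y j (ts @ [0]) = y (j - 1) ts)"

end

theory Submission
  imports Defs
begin

text \<open>
  Each field \<open>v\<^sub>s\<close> is orthogonal to all gradients \<open>\<nabla>F\<^sub>k\<close>, so every \<open>F\<^sub>k\<close> is constant along integral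
  curves.  Starting from \<open>F\<^sub>k(x\<^sup>0) = 0\<close>, each step of the iterated system extends the vanishing
  along one further curve.
\<close>

text \<open>Expanding \<open>w\<close> in the standard basis and using linearity of the derivative
  leaves only its values on \<open>axis i 1\<close>, which are the partial derivatives. This turns
  the output of the chain rule into the inner product that \<open>is_field_vector\<close> makes
  zero.\<close>

lemma frechet_derivative_eq_inner_grad:
  fixes f :: "real ^ 'n::finite \<Rightarrow> real"
  assumes "f differentiable (at x)"
  shows "frechet_derivative f (at x) w = w \<bullet> grad f x"
proof -
  have lin: "linear (frechet_derivative f (at x))"
    using assms by (rule linear_frechet_derivative)
  have "frechet_derivative f (at x) w = frechet_derivative f (at x) (\<Sum>i\<in>UNIV. w $ i *s axis i 1)"
    by (simp add: basis_expansion)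
  also have "\<dots> = (\<Sum>i\<in>UNIV. w $ i * frechet_derivative f (at x) (axis i 1))"
    by (simp add: linear_sum[OF lin] scalar_mult_eq_scaleR linear_scale[OF lin])
  finally show ?thesis
    by (simp add: inner_vec_def grad_def partial_deriv_def)
qed

lemma is_field_vector_vfield:
  fixes F :: "'l::finite \<Rightarrow> real ^ ('l + 'm::finite) \<Rightarrow> real"
  assumes "Delta F x \<noteq> 0"
  shows "is_field_vector F s x (vfield F s x)"
  unfolding vfield_def by (rule theI'[OF ex1_is_field_vector[OF assms]])

text \<open>By the chain rule the composite has derivative zero at each point of \<open>J\<close>,
  and \<open>J\<close> is convex. All derivatives along the curve are taken within \<open>J\<close>,
  so one-sided derivatives at end points suffice.\<close>

lemma const_along_vfield_curve:
  fixes F :: "'l::finite \<Rightarrow> real ^ ('l + 'm::finite) \<Rightarrow> real"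
    and c :: "real \<Rightarrow> real ^ ('l + 'm)"
  assumes J: "is_interval J" and st: "a \<in> J" "b \<in> J"
    and diff: "\<And>t. t \<in> J \<Longrightarrow> F k differentiable (at (c t))"
    and nz: "\<And>t. t \<in> J \<Longrightarrow> Delta F (c t) \<noteq> 0"
    and der: "\<And>t. t \<in> J \<Longrightarrow> (c has_vector_derivative vfield F s (c t)) (at t within J)"
  shows "F k (c a) = F k (c b)"
proof -
  have "((F k \<circ> c) has_derivative (\<lambda>h. 0)) (at t within J)" if t: "t \<in> J" for t
  proof -
    have "(F k has_derivative frechet_derivative (F k) (at (c t))) (at (c t) within c ` J)"
      using diff[OF t] frechet_derivative_works has_derivative_at_withinI by blast
    from vector_derivative_diff_chain_within[OF der[OF t] this]
    have "((F k \<circ> c) has_vector_derivative vfield F s (c t) \<bullet> grad (F k) (c t)) (at t within J)"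
      by (simp add: frechet_derivative_eq_inner_grad[OF diff[OF t]])
    moreover have "vfield F s (c t) \<bullet> grad (F k) (c t) = 0"
      using is_field_vector_vfield[OF nz[OF t]] by (auto simp: is_field_vector_def)
    ultimately show ?thesis
      by (simp add: has_vector_derivative_def)
  qed
  moreover have "convex J"
    using J by (simp add: is_interval_convex)
  ultimately obtain d where "\<forall>t\<in>J. (F k \<circ> c) t = d"
    using has_derivative_zero_constant[of J "F k \<circ> c"] by blast
  with st show ?thesis
    by simp
qed

text \<open>The last parameter is the time along the newest curve; the preceding ones stay fixed and
  select its starting point.\<close>

lemma param_box_SucE:
  assumes "ts \<in> param_box I (Suc j)"
  obtains us t where "ts = us @ [t]" "us \<in> param_box I j" "t \<in> I (Suc j)"
proof -
  from assms have "length ts = Suc j" and mem: "\<And>i. i < Suc j \<Longrightarrow> ts ! i \<in> I (Suc i)"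
    by (auto simp: param_box_def)
  then obtain us t where ts: "ts = us @ [t]" and len: "length us = j"
    by (metis length_Suc_conv_rev)
  have "us ! i \<in> I (Suc i)" if "i < j" for i
    using mem[of i] that by (simp add: ts len nth_append)
  moreover have "t \<in> I (Suc j)"
    using mem[of j] by (simp add: ts len nth_append)
  ultimately show thesis
    using that ts len by (auto simp: param_box_def)
qed

lemma snoc_in_param_box:
  assumes "us \<in> param_box I j" "t \<in> I (Suc j)"
  shows "us @ [t] \<in> param_box I (Suc j)"
  using assms by (auto simp: param_box_def nth_append less_Suc_eq)

theorem theorem4:
  fixes F :: "'l::finite \<Rightarrow> real ^ ('l + 'm::finite) \<Rightarrow> real"
    and \<Omega> V :: "(real ^ ('l + 'm)) set"
    and x0 :: "real ^ ('l + 'm)"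
    and e :: "nat \<Rightarrow> 'm"
    and I :: "nat \<Rightarrow> real set"
    and y :: "nat \<Rightarrow> real list \<Rightarrow> real ^ ('l + 'm)"
  assumes "open \<Omega>" and "connected \<Omega>" and "bounded \<Omega>" and "x0 \<in> \<Omega>"
    and "\<And>k. C1_on \<Omega> (F k)"
    and "\<And>k. F k x0 = 0"
    and "Delta F x0 \<noteq> 0"
    and "open V" and "x0 \<in> V" and "V \<subseteq> \<Omega>" and "\<And>x. x \<in> V \<Longrightarrow> Delta F x \<noteq> 0"
    and "bij_betw e {1..CARD('m)} (UNIV :: 'm set)"
    and "\<And>j. j \<in> {1..CARD('m)} \<Longrightarrow> is_interval (I j) \<and> closed (I j) \<and> 0 \<in> interior (I j)"
    and "iterated_solution F e x0 V I y"
  shows "\<forall>k. \<forall>j\<in>{1..CARD('m)}. \<forall>ts\<in>param_box I j. F k (y j ts) = 0"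
proof -
  note sol = assms(14)[unfolded iterated_solution_def]
  \<comment> \<open>Moving the last time back to 0 leaves \<open>F k\<close> unchanged and reaches
    the point where the initial condition of the stage applies.\<close>
  have restart: "F k (y (Suc j) (us @ [t])) = F k (y (Suc j) (us @ [0]))"
    if j: "Suc j \<le> CARD('m)" and us: "us \<in> param_box I j" and t: "t \<in> I (Suc j)" for k j us t
  proof (rule const_along_vfield_curve[where c = "\<lambda>\<tau>. y (Suc j) (us @ [\<tau>])"])
    have jm: "Suc j \<in> {1..CARD('m)}"
      using j by simp
    show "is_interval (I (Suc j))" "0 \<in> I (Suc j)"
      using assms(13)[OF jm] interior_subset by auto
    have inV: "y (Suc j) (us @ [\<tau>]) \<in> V" if "\<tau> \<in> I (Suc j)" for \<tau>
      using sol jm snoc_in_param_box[OF us that] by blast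
    show "F k differentiable (at (y (Suc j) (us @ [\<tau>])))" if "\<tau> \<in> I (Suc j)" for \<tau>
      using inV[OF that] assms(5)[of k] assms(10) by (auto simp: C1_on_def)
    show "Delta F (y (Suc j) (us @ [\<tau>])) \<noteq> 0" if "\<tau> \<in> I (Suc j)" for \<tau>
      using inV[OF that] assms(11) by blast
    show "((\<lambda>\<tau>. y (Suc j) (us @ [\<tau>])) has_vector_derivative
        vfield F (e (Suc j)) (y (Suc j) (us @ [\<tau>]))) (at \<tau> within I (Suc j))"
      if "\<tau> \<in> I (Suc j)" for \<tau>
      using sol jm us that by (metis diff_Suc_1)
  qed (rule t)
  \<comment> \<open>Stages are numbered from 1, so the induction runs on the predecessor of the
    stage.\<close>
  have "F k (y (Suc j) ts) = 0" if "Suc j \<le> CARD('m)" "ts \<in> param_box I (Suc j)" for k j ts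
    using that
  proof (induction j arbitrary: ts)
    case (0 ts)
    from 0(2) obtain us t where "ts = us @ [t]" "us \<in> param_box I 0" "t \<in> I (Suc 0)"
      by (rule param_box_SucE)
    \<comment> \<open>Stage 1 has no earlier parameters, so its curve starts at
      \<open>y 1 [0] = x0\<close>, where \<open>F k\<close> vanishes.\<close>
    moreover have "us = []"
      using calculation by (simp add: param_box_def)
    ultimately show ?case
      using restart[OF 0(1), of us t k] sol assms(6) by simp
  next
    case (Suc j ts)
    from Suc.prems(2) obtain us t
      where ts: "ts = us @ [t]" and us: "us \<in> param_box I (Suc j)" and t: "t \<in> I (Suc (Suc j))"
      by (rule param_box_SucE)
    \<comment> \<open>From stage 2 on, the curve starts at a value of the previous stage, which the
      induction hypothesis covers.\<close>
    have "Suc (Suc j) \<in> {2..CARD('m)}"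
      using Suc.prems(1) by simp
    then have "y (Suc (Suc j)) (us @ [0]) = y (Suc j) us"
      using sol us by (metis diff_Suc_1)
    then show ?case
      using restart[OF Suc.prems(1) us t] Suc.IH[OF _ us] Suc.prems(1) ts by simp
  qed
  then show ?thesis
    by (metis One_nat_def Suc_le_D atLeastAtMost_iff)
qed

end
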